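(* Let $(X,d)$ be a bounded Lorentzian-metric space, let $T$ be any topology on $X$ that satisfies (ii), and let $T'$ be the topology associated with $T$ as described in the context. Then $T'$ (on $X$) and $\mathring{T}=\mathring{T}'$ (on $\mathring X$) are the initial topologies of the family of functions $\{d_p,d^p: p\in X\}$ (restricted to $\mathring X$ in the second case). More precisely, the sets of the form $$\{q: a<d(p,q)<b\}\cap\{q: c<d(q,r)<e\},\qquad p,r\in X,\ a,b,c,e\in\mathbb{R}\cup\{-\infty,\infty\},$$ form a subbasis for these topologies. As a consequence, $\mathscr{T}=T'$ and $\mathring{\mathscr{T}}=\mathring{T}'=\mathring{T}$; thus $d$ is continuous for $\mathscr{T}\times\mathscr{T}$, the sets $\{d\ge\epsilon\}$ for $\epsilon>0$ are $\mathscr{T}\times\mathscr{T}$-compact (so $\mathscr{T}$ satisfies (ii) and is the coarsest topology that does), and $\mathscr{T}$ is uniquely determined by $d$, having as subbasis the sets displayed above. Moreover, if $i^0\in X$ then $(X,\mathscr{T})$ is compact.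
   Context: A bounded Lorentzian-metric space $(X,d)$ is a set $X$ with a map $d\colon X\times X\to[0,\infty)$ such that: (i) if $d(x,y)>0$ and $d(y,z)>0$ then $d(x,z)\ge d(x,y)+d(y,z)$; (ii) there is a topology $T$ on $X$ such that $d$ is continuous for $T\times T$ and for every $\epsilon>0$ the set $\{(p,q): d(p,q)\ge\epsilon\}$ is compact for $T\times T$; (iii) for every $x\ne y$ there is $z$ with $d(x,z)\ne d(y,z)$ or $d(z,x)\ne d(z,y)$. "A topology $T$ satisfies (ii)" means it has the two properties listed in (ii). $\mathscr{T}$ denotes the intersection of all topologies that satisfy (ii). $i^0$ denotes the (unique if it exists) point of $X$ with $d(i^0,p)=d(p,i^0)=0$ for all $p\in X$. Set $\mathring X=X\setminus\{i^0\}$ (so $\mathring X=X$ if $X$ has no such point), and for a topology $T$ on $X$ let $\mathring T$ be the induced topology on $\mathring X$. Set $d_p=d(p,\cdot)$ and $d^p=d(\cdot,p)$. Given $T$ satisfying (ii): if $i^0\in X$, $T'$ is the topology on $X$ having the same neighborhood systems as $T$ at the points of $\mathring X$, and at $i^0$ the neighborhood system generated by finite intersections of the sets $X\setminus\{d_p\ge b\}$ and $X\setminus\{d^p\ge b\}$ with $b>0$, $p\in X$ (it is coarser than $T$). If $i^0\notin X$, $T'=T$. *)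

theory Defs
  imports "HOL-Analysis.Analysis"
begin

text \<open>
  A space is a carrier set \<open>X\<close> with a function \<open>d\<close> whose values matter only on \<open>X \<times> X\<close>.
  A topology on \<open>X\<close> is a library topology whose \<^const>\<open>topspace\<close> is \<open>X\<close>.
\<close>

definition satisfies_ii :: "'a set \<Rightarrow> ('a \<Rightarrow> 'a \<Rightarrow> real) \<Rightarrow> 'a topology \<Rightarrow> bool" where
  "satisfies_ii X d T \<longleftrightarrow>
     topspace T = X \<and>
     continuous_map (prod_topology T T) euclideanreal (\<lambda>(p, q). d p q) \<and>
     (\<forall>\<epsilon>>0. compactin (prod_topology T T) {(p, q). p \<in> X \<and> q \<in> X \<and> d p q \<ge> \<epsilon>})"

definition bounded_lorentzian_metric_space :: "'a set \<Rightarrow> ('a \<Rightarrow> 'a \<Rightarrow> real) \<Rightarrow> bool" where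
  "bounded_lorentzian_metric_space X d \<longleftrightarrow>
     (\<forall>x\<in>X. \<forall>y\<in>X. d x y \<ge> 0) \<and>
     (\<forall>x\<in>X. \<forall>y\<in>X. \<forall>z\<in>X. d x y > 0 \<longrightarrow> d y z > 0 \<longrightarrow> d x z \<ge> d x y + d y z) \<and>
     (\<exists>T. satisfies_ii X d T) \<and>
     (\<forall>x\<in>X. \<forall>y\<in>X. x \<noteq> y \<longrightarrow> (\<exists>z\<in>X. d x z \<noteq> d y z \<or> d z x \<noteq> d z y))"

text \<open>The point \<open>i\<^sup>0\<close> may fail to exist, so it is given by a predicate; it is unique by
  \<open>is_i0_unique\<close> below.\<close>

definition is_i0 :: "'a set \<Rightarrow> ('a \<Rightarrow> 'a \<Rightarrow> real) \<Rightarrow> 'a \<Rightarrow> bool" where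
  "is_i0 X d x \<longleftrightarrow> x \<in> X \<and> (\<forall>p\<in>X. d x p = 0 \<and> d p x = 0)"

definition ring_set :: "'a set \<Rightarrow> ('a \<Rightarrow> 'a \<Rightarrow> real) \<Rightarrow> 'a set" where
  "ring_set X d = X - {x. is_i0 X d x}"

definition coarser :: "'a topology \<Rightarrow> 'a topology \<Rightarrow> bool" where
  "coarser S T \<longleftrightarrow> (\<forall>U. openin S U \<longrightarrow> openin T U)"

definition coarse_topology :: "'a set \<Rightarrow> ('a \<Rightarrow> 'a \<Rightarrow> real) \<Rightarrow> 'a topology" where
  "coarse_topology X d =
     topology (\<lambda>U. U \<subseteq> X \<and> (\<forall>T. satisfies_ii X d T \<longrightarrow> openin T U))"

definition nbhds_at :: "'a topology \<Rightarrow> 'a \<Rightarrow> 'a set set" where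
  "nbhds_at T x = {N. N \<subseteq> topspace T \<and> (\<exists>V. openin T V \<and> x \<in> V \<and> V \<subseteq> N)}"

definition i0_subbase :: "'a set \<Rightarrow> ('a \<Rightarrow> 'a \<Rightarrow> real) \<Rightarrow> 'a set set" where
  "i0_subbase X d =
     {X - {q \<in> X. d p q \<ge> b} | p b. p \<in> X \<and> b > 0} \<union>
     {X - {q \<in> X. d q p \<ge> b} | p b. p \<in> X \<and> b > 0}"

definition i0_nbhds :: "'a set \<Rightarrow> ('a \<Rightarrow> 'a \<Rightarrow> real) \<Rightarrow> 'a set set" where
  "i0_nbhds X d =
     {N. N \<subseteq> X \<and> (\<exists>F. finite F \<and> F \<subseteq> i0_subbase X d \<and> X \<inter> \<Inter>F \<subseteq> N)}"

text \<open>The topology \<open>T'\<close>: its open sets are the sets that are prescribed neighborhoods of each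
  of their points. \<open>nbhds_at_prime_topology\<close> below shows that its neighborhood systems are
  indeed the prescribed ones.\<close>

definition prime_topology ::
    "'a set \<Rightarrow> ('a \<Rightarrow> 'a \<Rightarrow> real) \<Rightarrow> 'a topology \<Rightarrow> 'a topology" where
  "prime_topology X d T =
     (if \<exists>z. is_i0 X d z
      then topology (\<lambda>U. U \<subseteq> X \<and>
             (\<forall>x\<in>U. U \<in> (if is_i0 X d x then i0_nbhds X d else nbhds_at T x)))
      else T)"

text \<open>The functions \<open>d\<^sub>p\<close> and \<open>d\<^sup>p\<close>.\<close>

definition dist_functions :: "'a set \<Rightarrow> ('a \<Rightarrow> 'a \<Rightarrow> real) \<Rightarrow> ('a \<Rightarrow> real) set" where
  "dist_functions X d = (\<lambda>p. \<lambda>q. d p q) ` X \<union> (\<lambda>p. \<lambda>q. d q p) ` X"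

text \<open>\<open>T\<close> is the initial topology on \<open>S\<close> of the restrictions to \<open>S\<close> of the functions in \<open>F\<close>;
  no restriction is written, since \<^const>\<open>continuous_map\<close> only sees values on \<^const>\<open>topspace\<close>.\<close>

definition is_initial_topology :: "'a set \<Rightarrow> ('a \<Rightarrow> real) set \<Rightarrow> 'a topology \<Rightarrow> bool" where
  "is_initial_topology S F T \<longleftrightarrow>
     topspace T = S \<and> (\<forall>f\<in>F. continuous_map T euclideanreal f) \<and>
     (\<forall>T'. topspace T' = S \<and> (\<forall>f\<in>F. continuous_map T' euclideanreal f) \<longrightarrow> coarser T T')"

text \<open>The empty intersection of members of a subbasis is the whole space.\<close>

definition is_subbasis :: "'a set set \<Rightarrow> 'a topology \<Rightarrow> bool" where
  "is_subbasis B T \<longleftrightarrow>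
     B \<subseteq> Pow (topspace T) \<and>
     T = topology (arbitrary union_of
           (finite intersection_of (\<lambda>U. U \<in> B) relative_to topspace T))"

text \<open>Traces on \<open>S\<close> of the sets \<open>{a < d\<^sub>p < b} \<inter> {c < d\<^sup>r < e}\<close>, with \<open>p\<close>, \<open>r\<close> in all of \<open>X\<close>.\<close>

definition strip_sets :: "'a set \<Rightarrow> ('a \<Rightarrow> 'a \<Rightarrow> real) \<Rightarrow> 'a set \<Rightarrow> 'a set set" where
  "strip_sets X d S =
     {{q \<in> S. a < ereal (d p q) \<and> ereal (d p q) < b} \<inter>
      {q \<in> S. c < ereal (d q r) \<and> ereal (d q r) < e}
      | p r a b c e. p \<in> X \<and> r \<in> X}"

lemma is_i0_unique:
  assumes "bounded_lorentzian_metric_space X d" "is_i0 X d x" "is_i0 X d y"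
  shows "x = y"
  using assms unfolding bounded_lorentzian_metric_space_def is_i0_def by metis

lemma openin_coarse_topology:
  "openin (coarse_topology X d) U \<longleftrightarrow>
     U \<subseteq> X \<and> (\<forall>T. satisfies_ii X d T \<longrightarrow> openin T U)"
proof -
  have "istopology (\<lambda>U. U \<subseteq> X \<and> (\<forall>T. satisfies_ii X d T \<longrightarrow> openin T U))"
    unfolding istopology_def by (auto intro: openin_Int)
  then show ?thesis
    by (simp add: coarse_topology_def topology_inverse')
qed

lemma openin_prime_topology:
  assumes z: "is_i0 X d z" and TX: "topspace T = X"
  shows "openin (prime_topology X d T) U \<longleftrightarrow>
    U \<subseteq> X \<and> (\<forall>x\<in>U. U \<in> (if is_i0 X d x then i0_nbhds X d else nbhds_at T x))"
    (is "_ \<longleftrightarrow> ?P U")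
proof -
  let ?N = "\<lambda>x. if is_i0 X d x then i0_nbhds X d else nbhds_at T x"
  have up: "B \<in> ?N x" if "A \<in> ?N x" "A \<subseteq> B" "B \<subseteq> X" for A B x
  proof (cases "is_i0 X d x")
    case True
    with that show ?thesis
      unfolding i0_nbhds_def by simp (meson subset_trans)
  next
    case False
    with that TX show ?thesis
      unfolding nbhds_at_def by simp (meson subset_trans)
  qed
  have int: "A \<inter> B \<in> ?N x" if A: "A \<in> ?N x" and B: "B \<in> ?N x" for A B x
  proof (cases "is_i0 X d x")
    case True
    obtain F G where "finite F" "F \<subseteq> i0_subbase X d" "X \<inter> \<Inter>F \<subseteq> A"
      and "finite G" "G \<subseteq> i0_subbase X d" "X \<inter> \<Inter>G \<subseteq> B"
      using A B True unfolding i0_nbhds_def by auto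
    then have "finite (F \<union> G) \<and> F \<union> G \<subseteq> i0_subbase X d \<and> X \<inter> \<Inter>(F \<union> G) \<subseteq> A \<inter> B"
      by auto
    moreover have "A \<inter> B \<subseteq> X"
      using A True unfolding i0_nbhds_def by auto
    ultimately have "A \<inter> B \<in> i0_nbhds X d"
      unfolding i0_nbhds_def by blast
    then show ?thesis
      using True by simp
  next
    case False
    obtain V W where "openin T V" "x \<in> V" "V \<subseteq> A" "openin T W" "x \<in> W" "W \<subseteq> B"
      using A B False unfolding nbhds_at_def by auto
    then have "openin T (V \<inter> W) \<and> x \<in> V \<inter> W \<and> V \<inter> W \<subseteq> A \<inter> B"
      by (auto intro: openin_Int)
    moreover have "A \<inter> B \<subseteq> topspace T"
      using A False unfolding nbhds_at_def by auto
    ultimately have "A \<inter> B \<in> nbhds_at T x"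
      unfolding nbhds_at_def by blast
    then show ?thesis
      using False by simp
  qed
  have "istopology ?P"
    unfolding istopology_def
  proof (intro conjI allI impI)
    fix A B assume A: "?P A" and B: "?P B"
    show "A \<inter> B \<subseteq> X" using conjunct1[OF A] by blast
    show "\<forall>x\<in>A \<inter> B. A \<inter> B \<in> ?N x"
    proof
      fix x assume x: "x \<in> A \<inter> B"
      show "A \<inter> B \<in> ?N x"
        by (rule int[OF bspec[OF conjunct2[OF A] IntD1[OF x]] bspec[OF conjunct2[OF B] IntD2[OF x]]])
    qed
  next
    fix K assume K: "\<forall>A\<in>K. ?P A"
    show U: "\<Union>K \<subseteq> X"
      by (rule Union_least) (rule conjunct1[OF bspec[OF K]])
    show "\<forall>x\<in>\<Union>K. \<Union>K \<in> ?N x"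
    proof
      fix x assume "x \<in> \<Union>K"
      then obtain A where A: "A \<in> K" "x \<in> A" by blast
      have "A \<in> ?N x" by (rule bspec[OF conjunct2[OF bspec[OF K A(1)]] A(2)])
      then show "\<Union>K \<in> ?N x" by (rule up) (use A U in auto)
    qed
  qed
  moreover have "prime_topology X d T = topology ?P"
    unfolding prime_topology_def using z by (subst if_P) auto
  ultimately show ?thesis
    by (simp only: topology_inverse')
qed

lemma nbhds_at_prime_topology:
  assumes L: "bounded_lorentzian_metric_space X d" and T: "satisfies_ii X d T"
    and z: "is_i0 X d z"
  shows "topspace (prime_topology X d T) = X"
    and "x \<in> ring_set X d \<Longrightarrow> nbhds_at (prime_topology X d T) x = nbhds_at T x"
    and "nbhds_at (prime_topology X d T) z = i0_nbhds X d"
proof -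
  let ?T' = "prime_topology X d T"
  have TX: "topspace T = X"
    using T by (simp add: satisfies_ii_def)
  note oT' = openin_prime_topology[OF z TX]
  have uniq: "is_i0 X d x \<longleftrightarrow> x = z" for x
    using is_i0_unique[OF L _ z] z by blast
  have zX: "z \<in> X" and z0: "\<And>p. p \<in> X \<Longrightarrow> d z p = 0 \<and> d p z = 0"
    using z by (auto simp: is_i0_def)
  have cont: "continuous_map (prod_topology T T) euclideanreal (\<lambda>(p, q). d p q)"
    using T by (simp add: satisfies_ii_def)
  have c1: "continuous_map T euclideanreal (d p)"
    and c2: "continuous_map T euclideanreal (\<lambda>q. d q p)" if "p \<in> X" for p
  proof -
    have "continuous_map T (prod_topology T T) (\<lambda>q. (p, q))"
      "continuous_map T (prod_topology T T) (\<lambda>q. (q, p))"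
      using that TX by (auto intro!: continuous_map_pairedI)
    from this[THEN continuous_map_compose, OF cont]
    show "continuous_map T euclideanreal (d p)" "continuous_map T euclideanreal (\<lambda>q. d q p)"
      by (simp_all add: o_def)
  qed
  have lev: "openin T {q \<in> X. f q \<in> U}" if "continuous_map T euclideanreal f" "open U"
    for f :: "'a \<Rightarrow> real" and U
    using that TX by (auto simp: continuous_map_def)
  have oS: "openin T S" "S \<subseteq> X" if S: "S \<in> i0_subbase X d" for S
  proof -
    have e: "X - {q \<in> X. f q \<ge> b} = {q \<in> X. f q \<in> {..<b}}" for f :: "'a \<Rightarrow> real" and b
      by auto
    show "openin T S" using S unfolding i0_subbase_def
      by (auto simp: e simp del: lessThan_iff intro!: lev c1 c2)
    then show "S \<subseteq> X" using TX openin_subset by blast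
  qed
  have fin: "openin T (X \<inter> \<Inter>F)" "openin ?T' (X \<inter> \<Inter>F)"
    if F: "finite F" "F \<subseteq> i0_subbase X d" for F
  proof -
    show 1: "openin T (X \<inter> \<Inter>F)"
    proof (cases "F = {}")
      case True
      then show ?thesis using TX openin_topspace by auto
    next
      case False
      then have "openin T (\<Inter>F)" using F oS by (intro openin_Inter) auto
      then show ?thesis using TX by (metis openin_Int openin_topspace)
    qed
    have "X \<inter> \<Inter>F \<in> i0_nbhds X d" unfolding i0_nbhds_def using F by blast
    moreover have "X \<inter> \<Inter>F \<in> nbhds_at T x" if "x \<in> X \<inter> \<Inter>F" for x
      unfolding nbhds_at_def using 1 that TX by blast
    ultimately show "openin ?T' (X \<inter> \<Inter>F)" unfolding oT' by auto
  qed
  have "openin ?T' X" using fin(2)[of "{}"] by simp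
  then show top: "topspace ?T' = X"
    using oT' by (metis openin_subset openin_topspace subset_antisym)
  have zcl: "openin T (X - {z})"
  proof (subst openin_subopen, intro ballI)
    fix x assume x: "x \<in> X - {z}"
    then obtain w where w: "w \<in> X" "d x w \<noteq> 0 \<or> d w x \<noteq> 0"
      using uniq[of x] unfolding is_i0_def by auto
    then consider "d x w \<noteq> 0" | "d w x \<noteq> 0" by blast
    then show "\<exists>V. openin T V \<and> x \<in> V \<and> V \<subseteq> X - {z}"
    proof cases
      case 1
      have "openin T {q \<in> X. d q w \<in> - {0}}" by (intro lev c2 w) auto
      then show ?thesis using 1 x w z0
        by (intro exI[of _ "{q \<in> X. d q w \<in> - {0}}"]) auto
    next
      case 2
      have "openin T {q \<in> X. d w q \<in> - {0}}" by (intro lev c1 w) auto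
      then show ?thesis using 2 x w z0
        by (intro exI[of _ "{q \<in> X. d w q \<in> - {0}}"]) auto
    qed
  qed
  show "nbhds_at ?T' x = nbhds_at T x" if x: "x \<in> ring_set X d"
  proof
    have nx: "\<not> is_i0 X d x" using x by (simp add: ring_set_def)
    show "nbhds_at ?T' x \<subseteq> nbhds_at T x"
    proof
      fix N assume "N \<in> nbhds_at ?T' x"
      then obtain V where V: "N \<subseteq> X" "openin ?T' V" "x \<in> V" "V \<subseteq> N"
        unfolding nbhds_at_def top by blast
      then have "V \<in> nbhds_at T x" using nx unfolding oT' by auto
      then show "N \<in> nbhds_at T x" using V TX unfolding nbhds_at_def by blast
    qed
    show "nbhds_at T x \<subseteq> nbhds_at ?T' x"
    proof
      fix N assume "N \<in> nbhds_at T x"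
      then obtain V where V: "N \<subseteq> X" "openin T V" "x \<in> V" "V \<subseteq> N"
        unfolding nbhds_at_def TX by blast
      have o: "openin T (V \<inter> (X - {z}))" using V zcl by (simp add: openin_Int)
      have "openin ?T' (V \<inter> (X - {z}))"
        unfolding oT' uniq using o TX by (auto simp: nbhds_at_def)
      moreover have "x \<in> V \<inter> (X - {z})" using V nx uniq by auto
      ultimately show "N \<in> nbhds_at ?T' x"
        unfolding nbhds_at_def top using V by blast
    qed
  qed
  show "nbhds_at ?T' z = i0_nbhds X d"
  proof
    show "nbhds_at ?T' z \<subseteq> i0_nbhds X d"
    proof
      fix N assume "N \<in> nbhds_at ?T' z"
      then obtain V where V: "N \<subseteq> X" "openin ?T' V" "z \<in> V" "V \<subseteq> N"
        unfolding nbhds_at_def top by blast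
      then have "V \<in> i0_nbhds X d" using z unfolding oT' by auto
      then obtain F where "finite F" "F \<subseteq> i0_subbase X d" "X \<inter> \<Inter>F \<subseteq> V"
        unfolding i0_nbhds_def by auto
      then show "N \<in> i0_nbhds X d"
        unfolding i0_nbhds_def using V by (intro CollectI conjI exI[of _ F]) auto
    qed
    show "i0_nbhds X d \<subseteq> nbhds_at ?T' z"
    proof
      fix N assume "N \<in> i0_nbhds X d"
      then obtain F where F: "N \<subseteq> X" "finite F" "F \<subseteq> i0_subbase X d" "X \<inter> \<Inter>F \<subseteq> N"
        unfolding i0_nbhds_def by blast
      moreover have "z \<in> X \<inter> \<Inter>F"
      proof -
        have "z \<in> S" if "S \<in> i0_subbase X d" for S
          using that zX z0 by (auto simp: i0_subbase_def)
        then show ?thesis using F(3) zX by blast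
      qed
      ultimately show "N \<in> nbhds_at ?T' z"
        unfolding nbhds_at_def top using fin(2)[OF F(2,3)]
        by (intro CollectI conjI exI[of _ "X \<inter> \<Inter>F"]) auto
    qed
  qed
qed

end

theory Submission
  imports Defs
begin

text \<open>
  Let \<open>I\<close> be the topology on \<open>X\<close> generated by the strips; it is the initial topology of
  the functions \<open>d\<^sub>p\<close> and \<open>d\<^sup>p\<close>. These functions are continuous for every topology \<open>T\<close> that
  satisfies (ii), so \<open>I\<close> is coarser than every such \<open>T\<close>, and it is Hausdorff, because (iii) says
  that these functions separate points. Everything rests on the comparison of \<open>I\<close> with one such \<open>T\<close>.

  Away from \<open>i\<^sup>0\<close> the two topologies agree. Some function \<open>f\<close> among the \<open>d\<^sub>p\<close>, \<open>d\<^sup>p\<close> is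
  positive at a given point \<open>x \<noteq> i\<^sup>0\<close>; if \<open>0 < e < f x\<close> then \<open>{f > e}\<close> is an \<open>I\<close>-neighborhood
  of \<open>x\<close> contained in \<open>{f \<ge> e}\<close>, which is \<open>T\<close>-compact by (ii). On a \<open>T\<close>-compact set a coarser
  Hausdorff topology coincides with \<open>T\<close> (lemmas \<open>openin_coarser_Hausdorff\<close> and
  \<open>openin_strip_topology_ring\<close>). At \<open>i\<^sup>0\<close> all the functions vanish and they are nonnegative, so an
  \<open>I\<close>-neighborhood of \<open>i\<^sup>0\<close> is only constrained by upper bounds on finitely many of them, as is
  an \<open>i\<^sup>0\<close>-neighborhood in \<open>T'\<close>. Hence \<open>I = T'\<close> (lemma \<open>prime_topology_eq_strip_topology\<close>).

  Moreover \<open>I\<close> itself satisfies (ii) (lemma \<open>satisfies_ii_strip_topology\<close>). The sets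
  \<open>{d \<ge> \<epsilon>}\<close> remain compact when the topology is made coarser, and then they are closed because
  \<open>I \<times> I\<close> is Hausdorff; this makes \<open>d\<close> upper semicontinuous. For lower semicontinuity, a set
  \<open>{d > a}\<close> with \<open>a \<ge> 0\<close> avoids \<open>i\<^sup>0\<close> in both coordinates, and there \<open>T\<close> and \<open>I\<close> agree. As \<open>I\<close> is
  coarser than all topologies with (ii) and is one of them, it is their intersection.
\<close>

section \<open>The functions \<open>d\<^sub>p\<close> and \<open>d\<^sup>p\<close>\<close>

lemma dist_functions_nonneg:
  assumes "bounded_lorentzian_metric_space X d" "f \<in> dist_functions X d" "q \<in> X"
  shows "0 \<le> f q"
  using assms unfolding bounded_lorentzian_metric_space_def dist_functions_def by auto

lemma dist_functions_separate_points:
  assumes "bounded_lorentzian_metric_space X d" "x \<in> X" "y \<in> X" "x \<noteq> y"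
  obtains f where "f \<in> dist_functions X d" "f x \<noteq> f y"
proof -
  have "\<forall>x\<in>X. \<forall>y\<in>X. x \<noteq> y \<longrightarrow> (\<exists>z\<in>X. d x z \<noteq> d y z \<or> d z x \<noteq> d z y)"
    using assms(1) unfolding bounded_lorentzian_metric_space_def by (elim conjE)
  then obtain z where z: "z \<in> X" "d x z \<noteq> d y z \<or> d z x \<noteq> d z y"
    using assms(2-4) by blast
  then have "d z \<in> dist_functions X d" "(\<lambda>q. d q z) \<in> dist_functions X d"
    by (auto simp: dist_functions_def)
  then show thesis
    using that[of "d z"] that[of "\<lambda>q. d q z"] z(2) by blast
qed

lemma dist_functions_i0:
  assumes "is_i0 X d z" "f \<in> dist_functions X d"
  shows "f z = 0"
  using assms unfolding is_i0_def dist_functions_def by auto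

lemma mem_ring_set_if_pos:
  assumes "p \<in> X" "q \<in> X" "0 < d p q"
  shows "p \<in> ring_set X d" "q \<in> ring_set X d"
proof -
  have "d p q \<noteq> 0"
    using assms(3) by simp
  then show "p \<in> ring_set X d" "q \<in> ring_set X d"
    using assms(1,2) unfolding ring_set_def is_i0_def by blast+
qed

lemma ring_set_eq:
  assumes "bounded_lorentzian_metric_space X d"
  shows "ring_set X d = {x \<in> X. \<exists>f\<in>dist_functions X d. 0 < f x}"
proof -
  have "is_i0 X d x \<longleftrightarrow> x \<in> X \<and> (\<forall>f\<in>dist_functions X d. f x = 0)" for x
    unfolding is_i0_def dist_functions_def by auto
  moreover have "f x \<noteq> 0 \<longleftrightarrow> 0 < f x" if "x \<in> X" "f \<in> dist_functions X d" for f x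
    using dist_functions_nonneg[OF assms] that by (simp add: less_le)
  ultimately show ?thesis
    unfolding ring_set_def by auto
qed

lemma continuous_map_dist_functions:
  assumes T: "satisfies_ii X d T" and f: "f \<in> dist_functions X d"
  shows "continuous_map T euclideanreal f"
proof -
  have TX: "topspace T = X"
    and d: "continuous_map (prod_topology T T) euclideanreal (\<lambda>(p, q). d p q)"
    using T by (auto simp: satisfies_ii_def)
  have "continuous_map T euclideanreal (d p) \<and> continuous_map T euclideanreal (\<lambda>q. d q p)"
    if p: "p \<in> X" for p
  proof -
    have "continuous_map T (prod_topology T T) (\<lambda>q. (p, q))"
      "continuous_map T (prod_topology T T) (\<lambda>q. (q, p))"
      using p TX by (auto intro!: continuous_map_pairedI)
    from this[THEN continuous_map_compose, OF d] show ?thesis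
      by (simp add: o_def)
  qed
  then show ?thesis
    using f unfolding dist_functions_def by auto
qed

text \<open>A superlevel set of \<open>d\<^sub>p\<close> or \<open>d\<^sup>p\<close> is closed, and it lies in one of the two projections
  of the compact set \<open>{d \<ge> e}\<close>. Since \<open>T\<close> need not be Hausdorff, closedness has to come from
  continuity and not from compactness.\<close>

lemma compactin_superlevel_set:
  assumes T: "satisfies_ii X d T" and f: "f \<in> dist_functions X d" and e: "0 < e"
  shows "compactin T {q \<in> X. e \<le> f q}"
proof -
  let ?D = "{(p, q). p \<in> X \<and> q \<in> X \<and> d p q \<ge> e}"
  have TX: "topspace T = X" and D: "compactin (prod_topology T T) ?D"
    using T e by (auto simp: satisfies_ii_def)
  have cl: "closedin T {q \<in> X. e \<le> f q}"
    using continuous_map_dist_functions[OF T f] TX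
    by (auto simp: continuous_map_upper_lower_semicontinuous_le)
  consider p where "p \<in> X" "f = d p" | p where "p \<in> X" "f = (\<lambda>q. d q p)"
    using f unfolding dist_functions_def by blast
  then show ?thesis
  proof cases
    case 1
    then have "{q \<in> X. e \<le> f q} \<subseteq> snd ` ?D"
      by force
    then show ?thesis
      using image_compactin[OF D continuous_map_snd] cl by (meson closed_compactin)
  next
    case 2
    then have "{q \<in> X. e \<le> f q} \<subseteq> fst ` ?D"
      by force
    then show ?thesis
      using image_compactin[OF D continuous_map_fst] cl by (meson closed_compactin)
  qed
qed

section \<open>The topology generated by the strips\<close>

definition strip_topology :: "'a set \<Rightarrow> ('a \<Rightarrow> 'a \<Rightarrow> real) \<Rightarrow> 'a set \<Rightarrow> 'a topology" where
  "strip_topology X d S =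
     topology (arbitrary union_of (finite intersection_of (\<lambda>U. U \<in> strip_sets X d S) relative_to S))"

lemma topspace_strip_topology [simp]: "topspace (strip_topology X d S) = S"
  by (simp add: strip_topology_def)

lemma strip_sets_subset: "strip_sets X d S \<subseteq> Pow S"
  unfolding strip_sets_def by auto

lemma strip_setsI:
  assumes "p \<in> X" "r \<in> X"
    and "U = {q \<in> S. a < ereal (d p q) \<and> ereal (d p q) < b} \<inter>
      {q \<in> S. c < ereal (d q r) \<and> ereal (d q r) < e}"
  shows "U \<in> strip_sets X d S"
  using assms unfolding strip_sets_def by blast

lemma is_subbasis_strip_sets_iff:
  assumes "topspace T = S"
  shows "is_subbasis (strip_sets X d S) T \<longleftrightarrow> T = strip_topology X d S"
  using assms strip_sets_subset[of X d S] unfolding is_subbasis_def strip_topology_def by auto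

lemma openin_strip_topology_strip:
  assumes "U \<in> strip_sets X d S"
  shows "openin (strip_topology X d S) U"
proof -
  have "(finite intersection_of (\<lambda>U. U \<in> strip_sets X d S) relative_to S) U"
    using assms strip_sets_subset[of X d S] by (intro relative_to_subset_inc finite_intersection_of_inc) auto
  then show ?thesis
    unfolding strip_topology_def openin_subbase by (rule arbitrary_union_of_inc)
qed

text \<open>A half-line \<open>{f < a}\<close> or \<open>{f > a}\<close> for \<open>f = d\<^sub>p\<close> is a strip with three infinite bounds,
  and \<open>p\<close> itself can serve as the base point of the factor that imposes no condition.\<close>

lemma continuous_map_strip_topology:
  assumes f: "f \<in> dist_functions X d"
  shows "continuous_map (strip_topology X d S) euclideanreal f"
proof -
  have strip: "{q \<in> S. a < ereal (d p q) \<and> ereal (d p q) < b} \<inter>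
      {q \<in> S. c < ereal (d q p) \<and> ereal (d q p) < e} \<in> strip_sets X d S"
    if "p \<in> X" for p a b c e
    by (rule strip_setsI[OF that that refl])
  have "{q \<in> S. a < f q} \<in> strip_sets X d S \<and> {q \<in> S. f q < a} \<in> strip_sets X d S" for a
  proof -
    consider p where "p \<in> X" "f = d p" | p where "p \<in> X" "f = (\<lambda>q. d q p)"
      using f unfolding dist_functions_def by auto
    then show ?thesis
    proof cases
      case 1
      then show ?thesis
        using strip[of p "ereal a" \<infinity> "-\<infinity>" \<infinity>] strip[of p "-\<infinity>" "ereal a" "-\<infinity>" \<infinity>]
        by (simp add: Collect_conj_eq Int_ac)
    next
      case 2
      then show ?thesis
        using strip[of p "-\<infinity>" \<infinity> "ereal a" \<infinity>] strip[of p "-\<infinity>" \<infinity> "-\<infinity>" "ereal a"]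
        by (simp add: Collect_conj_eq Int_ac)
    qed
  qed
  then show ?thesis
    unfolding continuous_map_upper_lower_semicontinuous_lt
    by (simp add: openin_strip_topology_strip)
qed

lemma openin_ereal_interval_preimage:
  assumes "continuous_map T euclideanreal f" and TS: "topspace T = S"
  shows "openin T {q \<in> S. a < ereal (f q) \<and> ereal (f q) < b}"
proof -
  have "open (ereal -` {a<..<b})"
    by (intro open_vimage) (auto intro: continuous_on_ereal continuous_on_id)
  then have "openin T {q \<in> topspace T. f q \<in> ereal -` {a<..<b}}"
    using assms(1) by (auto simp: continuous_map_def)
  then show ?thesis
    using TS by simp
qed

lemma coarser_strip_topology:
  assumes TS: "topspace T = S"
    and cont: "\<And>f. f \<in> dist_functions X d \<Longrightarrow> continuous_map T euclideanreal f"
  shows "coarser (strip_topology X d S) T"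
  unfolding coarser_def strip_topology_def
proof (intro allI impI)
  fix U
  assume U: "openin (topology (arbitrary union_of
      (finite intersection_of (\<lambda>U. U \<in> strip_sets X d S) relative_to S))) U"
  have "openin T V" if "V \<in> strip_sets X d S" for V
  proof -
    obtain p r a b c e where "p \<in> X" "r \<in> X" and
      V: "V = {q \<in> S. a < ereal (d p q) \<and> ereal (d p q) < b} \<inter>
        {q \<in> S. c < ereal (d q r) \<and> ereal (d q r) < e}"
      using \<open>V \<in> strip_sets X d S\<close> unfolding strip_sets_def by blast
    then have "continuous_map T euclideanreal (d p)" "continuous_map T euclideanreal (\<lambda>q. d q r)"
      using cont by (auto simp: dist_functions_def)
    then show ?thesis
      unfolding V by (intro openin_Int openin_ereal_interval_preimage TS)
  qed
  moreover have "openin T S"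
    using TS openin_topspace by blast
  ultimately show "openin T U"
    using U by (rule minimal_topology_subbase)
qed

lemma is_initial_topology_strip_topology:
  "is_initial_topology S (dist_functions X d) (strip_topology X d S)"
  unfolding is_initial_topology_def
  using continuous_map_strip_topology coarser_strip_topology by fastforce

text \<open>Both topologies on \<open>S\<close> are generated by traces of the same strips, because the base points
  of the strips in \<^term>\<open>strip_sets X d S\<close> range over all of \<open>X\<close>.\<close>

lemma subtopology_strip_topology:
  assumes SX: "S \<subseteq> X"
  shows "subtopology (strip_topology X d X) S = strip_topology X d S"
proof (rule topology_eq[THEN iffD2], intro allI iffI)
  fix U
  assume "openin (subtopology (strip_topology X d X) S) U"
  then obtain V where V: "openin (strip_topology X d X) V" "U = V \<inter> S"
    by (auto simp: openin_subtopology)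
  have "continuous_map (strip_topology X d S) (strip_topology X d X) id"
    unfolding strip_topology_def[of X d X]
  proof (rule continuous_map_into_topology_subbase)
    fix W assume "W \<in> strip_sets X d X"
    then obtain p r a b c e where "p \<in> X" "r \<in> X" and
      W: "W = {q \<in> X. a < ereal (d p q) \<and> ereal (d p q) < b} \<inter>
        {q \<in> X. c < ereal (d q r) \<and> ereal (d q r) < e}"
      unfolding strip_sets_def by blast
    have "{q \<in> S. q \<in> W} \<in> strip_sets X d S"
      by (rule strip_setsI[OF \<open>p \<in> X\<close> \<open>r \<in> X\<close>, of _ S a d b c e]) (use SX W in auto)
    then show "openin (strip_topology X d S) {q \<in> topspace (strip_topology X d S). id q \<in> W}"
      by (simp add: openin_strip_topology_strip)
  qed (use SX in auto)
  then have "openin (strip_topology X d S) {q \<in> S. q \<in> V}"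
    using V unfolding continuous_map_def by auto
  moreover have "{q \<in> S. q \<in> V} = U"
    using V by auto
  ultimately show "openin (strip_topology X d S) U"
    by simp
next
  fix U
  assume U: "openin (strip_topology X d S) U"
  have "coarser (strip_topology X d S) (subtopology (strip_topology X d X) S)"
    by (intro coarser_strip_topology continuous_map_from_subtopology continuous_map_strip_topology)
      (use SX in auto)
  then show "openin (subtopology (strip_topology X d X) S) U"
    using U by (simp add: coarser_def)
qed

lemma Hausdorff_space_strip_topology:
  assumes L: "bounded_lorentzian_metric_space X d"
  shows "Hausdorff_space (strip_topology X d X)"
  unfolding Hausdorff_space_def topspace_strip_topology
proof (intro allI impI, elim conjE)
  fix x y
  assume xy: "x \<in> X" "y \<in> X" "x \<noteq> y"
  obtain f where f: "f \<in> dist_functions X d" "f x \<noteq> f y"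
    using dist_functions_separate_points[OF L xy] .
  define m where "m = (f x + f y) / 2"
  have o: "openin (strip_topology X d X) {q \<in> X. f q < m}"
    "openin (strip_topology X d X) {q \<in> X. m < f q}"
    using continuous_map_strip_topology[OF f(1), of X]
    by (auto simp: continuous_map_upper_lower_semicontinuous_lt)
  have dj: "disjnt {q \<in> X. f q < m} {q \<in> X. m < f q}"
    "disjnt {q \<in> X. m < f q} {q \<in> X. f q < m}"
    by (auto simp: disjnt_def)
  consider "f x < m \<and> m < f y" | "f y < m \<and> m < f x"
    using f(2) unfolding m_def by fastforce
  then show "\<exists>U V. openin (strip_topology X d X) U \<and> openin (strip_topology X d X) V \<and>
      x \<in> U \<and> y \<in> V \<and> disjnt U V"
    using o dj xy by cases blast+
qed

section \<open>Comparison of topologies away from \<open>i\<^sup>0\<close>\<close>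

lemma continuous_map_coarser_id:
  assumes "coarser S T" "topspace S = topspace T"
  shows "continuous_map T S id"
  using assms topology_finer_continuous_id[of S T] unfolding coarser_def by simp

text \<open>This is the local form of the fact that a continuous bijection from a compact space to
  a Hausdorff space is a homeomorphism: the part of \<open>K\<close> outside \<open>U\<close> is compact for \<open>T\<close>, hence
  compact and so closed for \<open>S\<close>, and removing it from \<open>W\<close> leaves \<open>U \<inter> W\<close>.\<close>

lemma openin_coarser_Hausdorff:
  assumes S: "coarser S T" "topspace S = topspace T" "Hausdorff_space S"
    and K: "compactin T K" and W: "openin S W" "W \<subseteq> K" and U: "openin T U"
  shows "openin S (U \<inter> W)"
proof -
  have "compactin T ((topspace T - U) \<inter> K)"
    using U K by (intro closed_Int_compactin) auto
  then have "compactin S (id ` ((topspace T - U) \<inter> K))"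
    using continuous_map_coarser_id[OF S(1,2)] by (rule image_compactin)
  then have "closedin S ((topspace T - U) \<inter> K)"
    using S(3) by (simp add: compactin_imp_closedin)
  then have "openin S (W - (topspace T - U) \<inter> K)"
    using W(1) by (intro openin_diff)
  moreover have "W - (topspace T - U) \<inter> K = U \<inter> W"
    using W openin_subset[OF W(1)] S(2) by auto
  ultimately show ?thesis
    by simp
qed

lemma coarser_strip_topology_satisfies_ii:
  assumes "satisfies_ii X d T"
  shows "coarser (strip_topology X d X) T"
proof (rule coarser_strip_topology)
  show "topspace T = X"
    using assms by (simp add: satisfies_ii_def)
qed (rule continuous_map_dist_functions[OF assms])

text \<open>The sets \<open>{f > e}\<close> with \<open>e > 0\<close> cover \<open>X\<close> without \<open>i\<^sup>0\<close>, and each of them lies in the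
  compact set \<open>{f \<ge> e}\<close>, where the two topologies agree.\<close>

lemma openin_strip_topology_ring:
  assumes L: "bounded_lorentzian_metric_space X d" and T: "satisfies_ii X d T"
    and U: "openin T U" and ring: "U \<subseteq> ring_set X d"
  shows "openin (strip_topology X d X) U"
proof (subst openin_subopen, intro ballI)
  fix x
  assume x: "x \<in> U"
  then obtain f where f: "f \<in> dist_functions X d" "0 < f x" and xX: "x \<in> X"
    using ring unfolding ring_set_eq[OF L] by blast
  define e where "e = f x / 2"
  have e: "0 < e" "e < f x"
    using f by (auto simp: e_def)
  let ?W = "{q \<in> X. e < f q}"
  have "openin (strip_topology X d X) ?W"
    using continuous_map_strip_topology[OF f(1), of X]
    by (auto simp: continuous_map_upper_lower_semicontinuous_lt)
  then have "openin (strip_topology X d X) (U \<inter> ?W)"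
    using T U by (intro openin_coarser_Hausdorff[OF coarser_strip_topology_satisfies_ii[OF T] _
          Hausdorff_space_strip_topology[OF L] compactin_superlevel_set[OF T f(1) e(1)]])
      (auto simp: satisfies_ii_def)
  then show "\<exists>V. openin (strip_topology X d X) V \<and> x \<in> V \<and> V \<subseteq> U"
    using x xX e by (intro exI[of _ "U \<inter> ?W"]) auto
qed

lemma openin_ring_set:
  assumes L: "bounded_lorentzian_metric_space X d"
  shows "openin (strip_topology X d X) (ring_set X d)"
proof -
  have "openin (strip_topology X d X) (\<Union>f\<in>dist_functions X d. {x \<in> X. 0 < f x})"
    using continuous_map_strip_topology[of _ X d X]
    by (intro openin_Union) (auto simp: continuous_map_upper_lower_semicontinuous_lt)
  moreover have "(\<Union>f\<in>dist_functions X d. {x \<in> X. 0 < f x}) = ring_set X d"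
    unfolding ring_set_eq[OF L] by auto
  ultimately show ?thesis
    by simp
qed

lemma subtopology_ring_set:
  assumes L: "bounded_lorentzian_metric_space X d" and T: "satisfies_ii X d T"
  shows "subtopology T (ring_set X d) = subtopology (strip_topology X d X) (ring_set X d)"
proof (rule topology_eq[THEN iffD2], intro allI)
  fix U
  have oI: "openin (strip_topology X d X) (ring_set X d)"
    by (rule openin_ring_set[OF L])
  then have oT: "openin T (ring_set X d)"
    using coarser_strip_topology_satisfies_ii[OF T] by (simp add: coarser_def)
  show "openin (subtopology T (ring_set X d)) U \<longleftrightarrow>
      openin (subtopology (strip_topology X d X) (ring_set X d)) U"
    unfolding openin_open_subtopology[OF oI] openin_open_subtopology[OF oT]
    using openin_strip_topology_ring[OF L T] coarser_strip_topology_satisfies_ii[OF T]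
    by (auto simp: coarser_def)
qed

section \<open>The topology \<open>T'\<close> and property (ii)\<close>

lemma continuous_map_prime_topology:
  assumes L: "bounded_lorentzian_metric_space X d" and T: "satisfies_ii X d T"
    and z: "is_i0 X d z" and f: "f \<in> dist_functions X d"
  shows "continuous_map (prime_topology X d T) euclideanreal f"
proof -
  have TX: "topspace T = X"
    using T by (simp add: satisfies_ii_def)
  note top = nbhds_at_prime_topology(1)[OF L T z]
  have open_prime: "openin (prime_topology X d T) U"
    if "openin T U" "z \<in> U \<Longrightarrow> U \<in> i0_nbhds X d" for U
    unfolding openin_prime_topology[OF z TX]
    using that openin_subset[OF that(1)] TX is_i0_unique[OF L _ z]
    by (auto simp: nbhds_at_def)
  have oT: "openin T {q \<in> X. a < f q}" "openin T {q \<in> X. f q < a}" for a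
    using continuous_map_dist_functions[OF T f] TX
    by (auto simp: continuous_map_upper_lower_semicontinuous_lt)
  have "openin (prime_topology X d T) {q \<in> X. a < f q}" for a
  proof (rule open_prime[OF oT(1)])
    \<comment> \<open>Since \<open>f z = 0\<close>, this set contains \<open>z\<close> only if it is all of \<open>X\<close>.\<close>
    assume "z \<in> {q \<in> X. a < f q}"
    then have "{q \<in> X. a < f q} = X"
      using dist_functions_i0[OF z f] dist_functions_nonneg[OF L f] by force
    then show "{q \<in> X. a < f q} \<in> i0_nbhds X d"
      unfolding i0_nbhds_def by (auto intro!: exI[of _ "{}"])
  qed
  moreover have "openin (prime_topology X d T) {q \<in> X. f q < a}" for a
  proof (rule open_prime[OF oT(2)])
    assume "z \<in> {q \<in> X. f q < a}"
    then have a: "0 < a"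
      using dist_functions_i0[OF z f] by simp
    have "{q \<in> X. f q < a} = X - {q \<in> X. a \<le> f q}"
      by auto
    also have "\<dots> \<in> i0_subbase X d"
      using f a unfolding dist_functions_def i0_subbase_def by auto
    finally show "{q \<in> X. f q < a} \<in> i0_nbhds X d"
      unfolding i0_nbhds_def by (auto intro!: exI[of _ "{{q \<in> X. f q < a}}"])
  qed
  ultimately show ?thesis
    unfolding continuous_map_upper_lower_semicontinuous_lt top by blast
qed

lemma i0_subbase_iff:
  "B \<in> i0_subbase X d \<longleftrightarrow> (\<exists>f\<in>dist_functions X d. \<exists>b>0. B = {q \<in> X. f q < b})"
proof -
  have "X - {q \<in> X. b \<le> f q} = {q \<in> X. f q < b}" for f :: "'a \<Rightarrow> real" and b
    by auto
  then show ?thesis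
    by (simp add: i0_subbase_def dist_functions_def bex_Un) blast
qed

lemma openin_strip_topology_i0_subbase:
  assumes "B \<in> i0_subbase X d"
  shows "openin (strip_topology X d X) B"
proof -
  obtain f b where f: "f \<in> dist_functions X d" and "B = {q \<in> X. f q < b}"
    using assms unfolding i0_subbase_iff by blast
  then show ?thesis
    using continuous_map_strip_topology[OF f, of X]
    by (simp add: continuous_map_upper_lower_semicontinuous_lt)
qed

text \<open>That \<open>T'\<close> is finer follows from the continuity of the functions for \<open>T'\<close>, as the strip
  topology is initial. Conversely, a \<open>T'\<close>-open set is a neighborhood for the strip topology of each of
  its points: at \<open>i\<^sup>0\<close> by the form of the prescribed neighborhoods, elsewhere by the comparison
  with \<open>T\<close>.\<close>

lemma prime_topology_eq_strip_topology:
  assumes L: "bounded_lorentzian_metric_space X d" and T: "satisfies_ii X d T"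
  shows "prime_topology X d T = strip_topology X d X"
proof (cases "\<exists>z. is_i0 X d z")
  case False
  then have "ring_set X d = X"
    by (auto simp: ring_set_def)
  then show ?thesis
    using subtopology_ring_set[OF L T] False T
    by (simp add: prime_topology_def satisfies_ii_def subtopology_superset)
next
  case True
  then obtain z where z: "is_i0 X d z" ..
  have TX: "topspace T = X"
    using T by (simp add: satisfies_ii_def)
  have "openin (strip_topology X d X) U" if U: "openin (prime_topology X d T) U" for U
  proof (subst openin_subopen, intro ballI)
    fix x
    assume x: "x \<in> U"
    have UX: "U \<subseteq> X" and N: "U \<in> (if is_i0 X d x then i0_nbhds X d else nbhds_at T x)"
      using U x unfolding openin_prime_topology[OF z TX] by auto
    show "\<exists>V. openin (strip_topology X d X) V \<and> x \<in> V \<and> V \<subseteq> U"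
    proof (cases "is_i0 X d x")
      case True
      then obtain F where F: "finite F" "F \<subseteq> i0_subbase X d" "X \<inter> \<Inter>F \<subseteq> U"
        using N unfolding i0_nbhds_def by auto
      \<comment> \<open>Inserting \<open>X\<close> keeps the intersection inside \<open>X\<close> even if \<open>F\<close> is empty.\<close>
      have "openin (strip_topology X d X) (\<Inter>(insert X F))"
        using F(1,2) openin_strip_topology_i0_subbase openin_topspace[of "strip_topology X d X"]
        by (intro openin_Inter) auto
      moreover have "x \<in> B" if "B \<in> F" for B
      proof -
        obtain f b where f: "f \<in> dist_functions X d" and "0 < b" "B = {q \<in> X. f q < b}"
          using F(2) \<open>B \<in> F\<close> i0_subbase_iff[of B X d] by blast
        then show ?thesis
          using dist_functions_i0[OF True f] x UX by auto
      qed
      then have "x \<in> \<Inter>(insert X F)"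
        using x UX by blast
      moreover have "\<Inter>(insert X F) \<subseteq> U"
        using F(3) by simp
      ultimately show ?thesis
        by blast
    next
      case False
      then obtain V where V: "openin T V" "x \<in> V" "V \<subseteq> U"
        using N unfolding nbhds_at_def by auto
      have xr: "x \<in> ring_set X d"
        using False x UX by (auto simp: ring_set_def)
      have "openin T (ring_set X d)"
        using openin_ring_set[OF L] coarser_strip_topology_satisfies_ii[OF T]
        by (simp add: coarser_def)
      then have "openin (strip_topology X d X) (V \<inter> ring_set X d)"
        using V by (intro openin_strip_topology_ring[OF L T]) auto
      then show ?thesis
        using V xr by (intro exI[of _ "V \<inter> ring_set X d"]) auto
    qed
  qed
  moreover have "coarser (strip_topology X d X) (prime_topology X d T)"
    by (rule coarser_strip_topology[OF nbhds_at_prime_topology(1)[OF L T z]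
          continuous_map_prime_topology[OF L T z]])
  ultimately show ?thesis
    unfolding topology_eq coarser_def by blast
qed

text \<open>Compactness passes to the coarser topology, and the Hausdorff property turns it into
  closedness of \<open>{d \<ge> b}\<close> for \<open>b > 0\<close>. This gives upper semicontinuity of \<open>d\<close> everywhere,
  including at the pairs with a coordinate \<open>i\<^sup>0\<close>, where \<open>d\<close> is only bounded from above in a
  nontrivial way.\<close>

lemma satisfies_ii_strip_topology:
  assumes L: "bounded_lorentzian_metric_space X d"
  shows "satisfies_ii X d (strip_topology X d X)"
proof -
  let ?I = "strip_topology X d X"
  let ?D = "\<lambda>e. {(p, q). p \<in> X \<and> q \<in> X \<and> d p q \<ge> e}"
  obtain T where T: "satisfies_ii X d T"
    using L unfolding bounded_lorentzian_metric_space_def by blast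
  have TX: "topspace T = X"
    and d: "continuous_map (prod_topology T T) euclideanreal (\<lambda>(p, q). d p q)"
    and DT: "\<And>e. 0 < e \<Longrightarrow> compactin (prod_topology T T) (?D e)"
    using T by (auto simp: satisfies_ii_def)
  have "continuous_map T ?I id"
    using continuous_map_coarser_id[OF coarser_strip_topology_satisfies_ii[OF T]] TX by simp
  then have "continuous_map (prod_topology T T) (prod_topology ?I ?I) id"
    using continuous_map_compose[OF continuous_map_fst, of T ?I id T]
      continuous_map_compose[OF continuous_map_snd, of T ?I id T]
    by (simp add: continuous_map_pairwise)
  then have DI: "compactin (prod_topology ?I ?I) (?D e)" if "0 < e" for e
    using image_compactin[OF DT[OF that]] by fastforce
  have H: "Hausdorff_space (prod_topology ?I ?I)"
    using Hausdorff_space_strip_topology[OF L] by (simp add: Hausdorff_space_prod_topology)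
  have nonneg: "0 \<le> d p q" if "p \<in> X" "q \<in> X" for p q
    using L that unfolding bounded_lorentzian_metric_space_def by blast
  have XX: "openin (prod_topology ?I ?I) (X \<times> X)"
    using openin_topspace[of "prod_topology ?I ?I"] by simp
  have less: "openin (prod_topology ?I ?I) {pq \<in> X \<times> X. (\<lambda>(p, q). d p q) pq < b}" for b
  proof (cases "0 < b")
    case True
    have "{pq \<in> X \<times> X. (\<lambda>(p, q). d p q) pq < b} = X \<times> X - ?D b"
      by auto
    then show ?thesis
      using XX compactin_imp_closedin[OF H DI[OF True]] by (simp add: openin_diff)
  next
    case False
    then have "{pq \<in> X \<times> X. (\<lambda>(p, q). d p q) pq < b} = {}"
      using nonneg by fastforce
    then show ?thesis
      by (simp only: openin_empty)
  qed
  have greater: "openin (prod_topology ?I ?I) {pq \<in> X \<times> X. a < (\<lambda>(p, q). d p q) pq}" (is "openin _ ?G")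
    for a
  proof (cases "0 \<le> a")
    case True
    have GT: "openin (prod_topology T T) ?G"
      using d TX by (simp add: continuous_map_upper_lower_semicontinuous_lt)
    show ?thesis
      unfolding openin_prod_topology_alt
    proof (intro allI impI)
      fix x y
      assume "(x, y) \<in> ?G"
      then obtain U V where UV: "openin T U" "openin T V" "x \<in> U" "y \<in> V" "U \<times> V \<subseteq> ?G"
        using GT unfolding openin_prod_topology_alt by meson
      \<comment> \<open>\<open>d\<close> is positive on \<open>U \<times> V\<close>, so neither factor contains \<open>i\<^sup>0\<close>.\<close>
      have pos: "p \<in> X \<and> q \<in> X \<and> 0 < d p q" if "p \<in> U" "q \<in> V" for p q
        using that subsetD[OF UV(5), of "(p, q)"] True by simp
      have "U \<subseteq> ring_set X d" "V \<subseteq> ring_set X d"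
        using pos[OF _ UV(4)] pos[OF UV(3)] by (meson mem_ring_set_if_pos subsetI)+
      then show "\<exists>U V. openin ?I U \<and> openin ?I V \<and> x \<in> U \<and> y \<in> V \<and> U \<times> V \<subseteq> ?G"
        using UV openin_strip_topology_ring[OF L T UV(1)] openin_strip_topology_ring[OF L T UV(2)]
        by (intro exI[of _ U] exI[of _ V] conjI)
    qed
  next
    case False
    then have "a < d p q" if "p \<in> X" "q \<in> X" for p q
      using nonneg[OF that] by linarith
    then have "?G = X \<times> X"
      by auto
    then show ?thesis
      using XX by (simp only:)
  qed
  have "continuous_map (prod_topology ?I ?I) euclideanreal (\<lambda>(p, q). d p q)"
    unfolding continuous_map_upper_lower_semicontinuous_lt
    using less greater by simp
  then show ?thesis
    unfolding satisfies_ii_def using DI by simp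
qed

lemma coarse_topology_eq_strip_topology:
  assumes L: "bounded_lorentzian_metric_space X d"
  shows "coarse_topology X d = strip_topology X d X"
  unfolding topology_eq openin_coarse_topology
proof (intro allI iffI)
  fix U
  assume "U \<subseteq> X \<and> (\<forall>T. satisfies_ii X d T \<longrightarrow> openin T U)"
  then show "openin (strip_topology X d X) U"
    using satisfies_ii_strip_topology[OF L] by blast
next
  fix U
  assume U: "openin (strip_topology X d X) U"
  then have "openin T U" if "satisfies_ii X d T" for T
    using coarser_strip_topology_satisfies_ii[OF that] unfolding coarser_def by blast
  moreover have "U \<subseteq> X"
    using openin_subset[OF U] by simp
  ultimately show "U \<subseteq> X \<and> (\<forall>T. satisfies_ii X d T \<longrightarrow> openin T U)"
    by blast
qed

text \<open>A member of an open cover that contains \<open>i\<^sup>0\<close> contains the complement of a finite union of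
  compact superlevel sets, and finitely many further members cover these.\<close>

lemma compact_space_strip_topology:
  assumes L: "bounded_lorentzian_metric_space X d" and z: "is_i0 X d z"
  shows "compact_space (strip_topology X d X)"
proof -
  let ?I = "strip_topology X d X"
  have I: "satisfies_ii X d ?I"
    by (rule satisfies_ii_strip_topology[OF L])
  have zX: "z \<in> X"
    using z by (simp add: is_i0_def)
  have cpt: "compactin ?I (X - B)" if B: "B \<in> i0_subbase X d" for B
  proof -
    obtain f b where fb: "f \<in> dist_functions X d" "0 < b" "B = {q \<in> X. f q < b}"
      using B unfolding i0_subbase_iff by blast
    then have "X - B = {q \<in> X. b \<le> f q}"
      by auto
    then show ?thesis
      using compactin_superlevel_set[OF I fb(1,2)] by simp
  qed
  have "\<exists>\<F>. finite \<F> \<and> \<F> \<subseteq> \<U> \<and> X \<subseteq> \<Union>\<F>"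
    if \<U>: "\<And>U. U \<in> \<U> \<Longrightarrow> openin ?I U" and cover: "X \<subseteq> \<Union>\<U>" for \<U>
  proof -
    obtain U where U: "U \<in> \<U>" "z \<in> U"
      using cover zX by blast
    have "openin (prime_topology X d ?I) U"
      using \<U>[OF U(1)] prime_topology_eq_strip_topology[OF L I] by simp
    then have "U \<in> i0_nbhds X d"
      using U(2) z unfolding openin_prime_topology[OF z topspace_strip_topology] by force
    then obtain F where F: "finite F" "F \<subseteq> i0_subbase X d" "X \<inter> \<Inter>F \<subseteq> U"
      unfolding i0_nbhds_def by auto
    have K: "compactin ?I (\<Union>B\<in>F. X - B)"
      using F(1,2) cpt by (intro compactin_Union) auto
    have "(\<Union>B\<in>F. X - B) \<subseteq> \<Union>\<U>"
      using cover by blast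
    with compactinD[OF K \<U>] obtain \<F> where \<F>: "finite \<F>" "\<F> \<subseteq> \<U>" "(\<Union>B\<in>F. X - B) \<subseteq> \<Union>\<F>"
      by meson
    have "X \<subseteq> \<Union>(insert U \<F>)"
      using F(3) \<F>(3) by auto
    moreover have "finite (insert U \<F>)" "insert U \<F> \<subseteq> \<U>"
      using \<F>(1,2) U(1) by auto
    ultimately show ?thesis
      by blast
  qed
  then show ?thesis
    by (simp add: compact_space_def compactin_def)
qed

section \<open>The coarsest topology with property (ii)\<close>


theorem corollary1p7:
  fixes X :: "'a set" and d :: "'a \<Rightarrow> 'a \<Rightarrow> real" and T :: "'a topology"
  assumes "bounded_lorentzian_metric_space X d"
    and "satisfies_ii X d T"
  shows
    "is_initial_topology X (dist_functions X d) (prime_topology X d T) \<and>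
     subtopology T (ring_set X d) = subtopology (prime_topology X d T) (ring_set X d) \<and>
     is_initial_topology (ring_set X d) (dist_functions X d) (subtopology T (ring_set X d)) \<and>
     is_subbasis (strip_sets X d X) (prime_topology X d T) \<and>
     is_subbasis (strip_sets X d (ring_set X d)) (subtopology T (ring_set X d)) \<and>
     coarse_topology X d = prime_topology X d T \<and>
     subtopology (coarse_topology X d) (ring_set X d)
       = subtopology (prime_topology X d T) (ring_set X d) \<and>
     continuous_map (prod_topology (coarse_topology X d) (coarse_topology X d))
       euclideanreal (\<lambda>(p, q). d p q) \<and>
     (\<forall>\<epsilon>>0. compactin (prod_topology (coarse_topology X d) (coarse_topology X d))
       {(p, q). p \<in> X \<and> q \<in> X \<and> d p q \<ge> \<epsilon>}) \<and>
     satisfies_ii X d (coarse_topology X d) \<and>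
     (\<forall>S. satisfies_ii X d S \<longrightarrow> coarser (coarse_topology X d) S) \<and>
     is_subbasis (strip_sets X d X) (coarse_topology X d) \<and>
     (\<forall>S. topspace S = X \<and> is_subbasis (strip_sets X d X) S \<longrightarrow> S = coarse_topology X d) \<and>
     ((\<exists>z. is_i0 X d z) \<longrightarrow> compact_space (coarse_topology X d))"
proof -
  note L = assms(1) and T = assms(2)
  have prime: "prime_topology X d T = strip_topology X d X"
    by (rule prime_topology_eq_strip_topology[OF L T])
  have coarse: "coarse_topology X d = strip_topology X d X"
    by (rule coarse_topology_eq_strip_topology[OF L])
  have ring: "subtopology T (ring_set X d) = strip_topology X d (ring_set X d)"
    "subtopology (strip_topology X d X) (ring_set X d) = strip_topology X d (ring_set X d)"
    using subtopology_ring_set[OF L T] subtopology_strip_topology[of "ring_set X d" X d]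
    by (auto simp: ring_set_def)
  have ii: "satisfies_ii X d (strip_topology X d X)"
    by (rule satisfies_ii_strip_topology[OF L])
  show ?thesis
    unfolding prime coarse ring
    using ii is_initial_topology_strip_topology[of _ X d]
      is_subbasis_strip_sets_iff[of "strip_topology X d _" _ X d]
      is_subbasis_strip_sets_iff[of _ X X d]
      coarser_strip_topology_satisfies_ii[of X d] compact_space_strip_topology[OF L]
    by (auto simp: satisfies_ii_def)
qed

end
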